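(* Let $E=\{f:\mathbb{R}\to\mathbb{R}\}$ be endowed with the locally convex topology generated by the seminorms $q_{x_0}(f)=|f(x_0)|$, $x_0\in\mathbb{R}$. For $n\in\mathbb{N}$ (with $n\geq 1$) define $\gamma_n:[0,1]\to E$ by \[ \gamma_n(t)(x)=\max\{1-n|x-t|,0\},\quad x\in\mathbb{R}, \] and define $\gamma:[0,1]\to E$ by $\gamma(t)(x)=1$ if $x=t$ and $\gamma(t)(x)=0$ if $x\neq t$. Then each $\gamma_n$ is continuous (hence Lusin-measurable), $(\gamma_n)_n$ converges pointwise to $\gamma$ on $[0,1]$, and $\gamma$ is not Lusin-measurable.
   Context: $\lambda$ is Lebesgue measure on $[0,1]$. A function $\gamma:[0,1]\to E$ is Lusin-measurable if for each $\varepsilon>0$ there is a compact $K_\varepsilon\subseteq[0,1]$ with $\lambda([0,1]\setminus K_\varepsilon)\leq\varepsilon$ and $\gamma|_{K_\varepsilon}$ continuous. *)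

theory Defs
  imports "HOL-Analysis.Analysis" "HOL-Library.Function_Algebras"
begin

(* The subbasic sets are all translates of open seminorm balls; inserting UNIV only makes the
   carrier the whole space when the family of seminorms is empty. *)
definition seminorm_topology :: "('a::ab_group_add \<Rightarrow> real) set \<Rightarrow> 'a topology" where
  "seminorm_topology Q =
     topology_generated_by (insert UNIV {{g. q (g - f) < r} | q f r. q \<in> Q \<and> r > 0})"

lemma topspace_seminorm_topology [simp]: "topspace (seminorm_topology Q) = UNIV"
  by (simp add: seminorm_topology_def)

definition point_seminorm :: "real \<Rightarrow> (real \<Rightarrow> real) \<Rightarrow> real" where
  "point_seminorm x0 f = \<bar>f x0\<bar>"

definition E_topology :: "(real \<Rightarrow> real) topology" where
  "E_topology = seminorm_topology (range point_seminorm)"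

(* Functions on [0,1] are represented by functions on the reals whose values outside [0,1]
   are irrelevant. *)
definition lusin_measurable :: "'a topology \<Rightarrow> (real \<Rightarrow> 'a) \<Rightarrow> bool" where
  "lusin_measurable Y \<gamma> \<longleftrightarrow>
     (\<forall>\<epsilon>>0. \<exists>K. compact K \<and> K \<subseteq> {0..1} \<and>
        measure (lebesgue_on {0..1}) ({0..1} - K) \<le> \<epsilon> \<and>
        continuous_map (top_of_set K) Y \<gamma>)"

definition gamma_seq :: "nat \<Rightarrow> real \<Rightarrow> real \<Rightarrow> real" where
  "gamma_seq n t x = max (1 - real n * \<bar>x - t\<bar>) 0"

definition gamma_lim :: "real \<Rightarrow> real \<Rightarrow> real" where
  "gamma_lim t x = (if x = t then 1 else 0)"

end

(* The topology of E is the product topology, so everything is checked coordinatewise. On a set K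
   where the limit is continuous, {t} = {s : K. |gamma_lim s t - 1| < 1} is relatively open for
   each t in K; hence K is discrete, and if compact then finite, so it cannot have measure close
   to 1. *)
theory Submission
  imports Defs
begin

text \<open>A seminorm ball for \<open>point_seminorm x\<close> constrains one coordinate only: it
  is the preimage of an open interval under evaluation at \<open>x\<close>. Both topologies are
  therefore the coarsest one making all evaluations continuous. The proof shows that the identity is
  continuous in both directions.\<close>

lemma E_topology_eq_product: "E_topology = product_topology (\<lambda>_. euclideanreal) UNIV"
proof -
  let ?P = "product_topology (\<lambda>_::real. euclideanreal) UNIV"
  have topE: "topspace E_topology = UNIV"
    by (simp add: E_topology_def)
  have ball_E: "openin E_topology {g. \<bar>g x - f x\<bar> < r}" if "r > 0" for f :: "real \<Rightarrow> real" and x r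
  proof -
    have "{g. \<bar>g x - f x\<bar> < r} = {g. point_seminorm x (g - f) < r}"
      by (simp add: point_seminorm_def)
    then show ?thesis
      unfolding E_topology_def seminorm_topology_def
      using that by (intro topology_generated_by_Basis) blast
  qed
  have coord_E: "continuous_map E_topology euclideanreal (\<lambda>f. f x)" for x
    unfolding continuous_map_def
  proof (intro conjI allI impI)
    fix U :: "real set" assume "openin euclideanreal U"
    then have U: "open U" by simp
    show "openin E_topology {f \<in> topspace E_topology. f x \<in> U}"
    proof (subst openin_subopen, intro ballI)
      fix f assume "f \<in> {f \<in> topspace E_topology. f x \<in> U}"
      then obtain r where "r > 0" and r: "\<And>y. \<bar>y - f x\<bar> < r \<Longrightarrow> y \<in> U"
        using U by (auto simp: open_dist dist_real_def)
      \<comment> \<open>The witness is the strip around \<open>f\<close> that restricts the value at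
        \<open>x\<close> alone; it is open by \<open>ball_E\<close>, and the choice of
        \<open>r\<close> sends it into \<open>U\<close>.\<close>
      then show "\<exists>T. openin E_topology T \<and> f \<in> T \<and> T \<subseteq> {f \<in> topspace E_topology. f x \<in> U}"
        using ball_E topE by (intro exI[of _ "{g. \<bar>g x - f x\<bar> < r}"]) auto
    qed
  qed simp
  have "continuous_map E_topology ?P id"
    by (simp add: continuous_map_componentwise_UNIV coord_E)
  moreover have "continuous_map ?P E_topology id"
    unfolding E_topology_def seminorm_topology_def
  proof (rule continuous_on_generated_topo)
    fix U :: "(real \<Rightarrow> real) set"
    assume "U \<in> insert UNIV {{g. q (g - f) < r} |q f r. q \<in> range point_seminorm \<and> r > 0}"
    then consider "U = UNIV" | x f r where "U = {g. \<bar>g x - f x\<bar> < r}"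
      by (auto simp: point_seminorm_def)
    then show "openin ?P (id -` U \<inter> topspace ?P)"
    proof cases
      case 1
      then show ?thesis by (metis Int_UNIV_left openin_topspace vimage_UNIV)
    next
      case (2 x f r)
      have "continuous_map ?P euclideanreal (\<lambda>g. g x)"
        by (rule continuous_map_product_projection) simp
      then have "openin ?P {g \<in> topspace ?P. g x \<in> ball (f x) r}"
        by (rule openin_continuous_map_preimage) simp
      then show ?thesis
        using 2
        by (simp add: vimage_def ball_def dist_real_def abs_minus_commute)
    qed
  qed simp
  \<comment> \<open>Both carriers are \<open>UNIV\<close>, so the preimage of \<open>U\<close> under
    \<open>id\<close> is \<open>U\<close> itself, and the two continuity statements are the two
    inclusions between the topologies.\<close>
  ultimately have "openin E_topology U = openin ?P U" for U
    using topE by (auto simp: continuous_map_def)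
  then show ?thesis
    by (simp add: topology_eq)
qed

lemma continuous_map_E_topology:
  "continuous_map X E_topology f \<longleftrightarrow> (\<forall>x. continuous_map X euclideanreal (\<lambda>t. f t x))"
  by (simp add: E_topology_eq_product continuous_map_componentwise_UNIV)

lemma limitin_E_topology:
  "limitin E_topology f l F \<longleftrightarrow> (\<forall>x. ((\<lambda>n. f n x) \<longlongrightarrow> l x) F)"
  by (simp add: E_topology_eq_product limitin_componentwise)

lemma lusin_measurable_continuous:
  assumes "continuous_map (top_of_set {0..1}) Y g"
  shows "lusin_measurable Y g"
  unfolding lusin_measurable_def using assms by (intro allI impI exI[of _ "{0..1}"]) simp

lemma continuous_gamma_seq: "continuous_map (top_of_set S) E_topology (gamma_seq n)"
  by (auto simp: continuous_map_E_topology gamma_seq_def intro!: continuous_intros)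

lemma gamma_seq_tendsto: "limitin E_topology (\<lambda>n. gamma_seq n t) (gamma_lim t) sequentially"
  unfolding limitin_E_topology
proof
  fix x
  show "(\<lambda>n. gamma_seq n t x) \<longlonglongrightarrow> gamma_lim t x"
  proof (cases "x = t")
    case True
    then show ?thesis by (simp add: gamma_seq_def gamma_lim_def)
  next
    case False
    \<comment> \<open>Once \<open>n * \<bar>x - t\<bar>\<close> exceeds 1, the tent of half-width
      1/n around \<open>t\<close> no longer reaches \<open>x\<close>, so the sequence is eventually
      0 there.\<close>
    then obtain N where N: "1 < real N * \<bar>x - t\<bar>"
      using reals_Archimedean3[of "\<bar>x - t\<bar>"] by auto
    have "gamma_seq n t x = 0" if "n \<ge> N" for n
    proof -
      have "real N * \<bar>x - t\<bar> \<le> real n * \<bar>x - t\<bar>"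
        using that by (intro mult_right_mono) auto
      with N show ?thesis by (simp add: gamma_seq_def)
    qed
    then have "\<forall>\<^sub>F n in sequentially. gamma_seq n t x = 0"
      by (auto simp: eventually_sequentially)
    then show ?thesis
      using False by (simp add: gamma_lim_def tendsto_eventually)
  qed
qed

lemma finite_if_continuous_gamma_lim:
  assumes "compact K" and cont: "continuous_map (top_of_set K) E_topology gamma_lim"
  shows "finite K"
proof -
  have "discrete_topology K = top_of_set K"
  proof (subst discrete_topology_unique, intro conjI ballI)
    fix t assume "t \<in> K"
    have "continuous_map (top_of_set K) euclideanreal (\<lambda>s. gamma_lim s t)"
      using cont by (simp add: continuous_map_E_topology)
    \<comment> \<open>The interval \<open>ball 1 1\<close> is (0,2): it contains the value 1, taken
      only at \<open>s = t\<close>, and excludes the value 0, taken at every other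
      \<open>s\<close>.\<close>
    then have "openin (top_of_set K) {s \<in> topspace (top_of_set K). gamma_lim s t \<in> ball 1 1}"
      by (rule openin_continuous_map_preimage) simp
    moreover have "{s \<in> topspace (top_of_set K). gamma_lim s t \<in> ball 1 1} = {t}"
      using \<open>t \<in> K\<close> by (auto simp: gamma_lim_def split: if_splits)
    ultimately show "openin (top_of_set K) {t}"
      by simp
  qed simp
  then have "compact_space (discrete_topology K)"
    using \<open>compact K\<close> by (simp add: compact_space_subtopology)
  then show ?thesis
    by (simp add: compact_space_discrete_topology)
qed

lemma not_lusin_measurable_gamma_lim: "\<not> lusin_measurable E_topology gamma_lim"
proof
  assume "lusin_measurable E_topology gamma_lim"
  \<comment> \<open>Any \<epsilon> in (0,1) would serve as well as 1/2, since removing a finite set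
    from the unit interval leaves measure 1.\<close>
  then obtain K where "compact K" and K01: "K \<subseteq> {0..1}"
    and le: "measure (lebesgue_on {0..1}) ({0..1} - K) \<le> 1/2"
    and cont: "continuous_map (top_of_set K) E_topology gamma_lim"
    unfolding lusin_measurable_def by (meson half_gt_zero zero_less_one)
  then have "finite K"
    by (simp add: finite_if_continuous_gamma_lim)
  have "measure (lebesgue_on {0..1}) ({0..1} - K) = measure lebesgue ({0..1} - K)"
    by (intro measure_restrict_space) auto
  \<comment> \<open>A finite set is negligible, so removing \<open>K\<close> does not change the
    measure.\<close>
  also have "\<dots> = measure lebesgue {0..1::real}"
    using \<open>finite K\<close> by (intro measure_Diff_null_set) (auto simp: negligible_iff_null_sets[symmetric])
  finally show False
    using le by simp
qed

theorem mainTheorem5: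
  "(\<forall>n\<ge>1. continuous_map (top_of_set {0..1}) E_topology (gamma_seq n) \<and>
           lusin_measurable E_topology (gamma_seq n)) \<and>
   (\<forall>t\<in>{0..1}. limitin E_topology (\<lambda>n. gamma_seq n t) (gamma_lim t) sequentially) \<and>
   \<not> lusin_measurable E_topology gamma_lim"
  using continuous_gamma_seq lusin_measurable_continuous[OF continuous_gamma_seq]
    gamma_seq_tendsto not_lusin_measurable_gamma_lim
  by blast

end
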